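(* Let $0<b<1<a$. Every probability distribution on $\mathbf{R}$ whose characteristic function $f$ is semi-stable$(a,b)$ is semi-selfdecomposable$(b)$; that is, there exists an infinitely divisible characteristic function $f_o$ such that $f(u)=f(bu)\,f_o(u)$ for all $u\in\mathbf{R}$.
   Context: Semi-stable law: let $0<b<1<a$, where $a$ and $b$ are connected by $ab^{\alpha}=1$ for some $\alpha\in(0,2]$. A characteristic function $f$ of a probability distribution on $\mathbf{R}$ is called semi-stable$(a,b)$ if $f$ has no zeros on $\mathbf{R}$ and $f(u)=\{f(bu)\}^{a}$ for all $u\in\mathbf{R}$. For a characteristic function $f$ without zeros and $s>0$, the power $\{f(u)\}^{s}$ means $\exp(s\log f(u))$, where $\log f$ is the unique continuous logarithm of $f$ with $\log f(0)=0$. Semi-selfdecomposable law: for $b\in(0,1)$, a probability distribution on $\mathbf{R}$ with characteristic function $f$ is semi-selfdecomposable$(b)$, abbreviated SSD$(b)$, if there exists an infinitely divisible characteristic function $f_o$ such that $f(u)=f(bu)f_o(u)$ for all $u\in\mathbf{R}$. *)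

theory Defs
  imports "HOL-Probability.Probability"
begin

text \<open>A probability distribution on the line is a measure satisfying \<^term>\<open>real_distribution\<close>
  (a probability measure on the Borel sets), and its characteristic function is \<^term>\<open>char\<close>.\<close>

definition characteristic_function :: "(real \<Rightarrow> complex) \<Rightarrow> bool" where
  "characteristic_function f \<longleftrightarrow> (\<exists>M. real_distribution M \<and> char M = f)"

definition infinitely_divisible_cf :: "(real \<Rightarrow> complex) \<Rightarrow> bool" where
  "infinitely_divisible_cf f \<longleftrightarrow> characteristic_function f \<and>
     (\<forall>n::nat. n \<ge> 1 \<longrightarrow> (\<exists>g. characteristic_function g \<and> (\<forall>u. f u = g u ^ n)))"

text \<open>The distinguished logarithm. The description is meaningful when \<open>f\<close> is continuous and
  has no zeros, and \<open>f 0 = 1\<close>; see \<open>ex1_continuous_log\<close> below.\<close>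

definition continuous_log :: "(real \<Rightarrow> complex) \<Rightarrow> real \<Rightarrow> complex" where
  "continuous_log f =
     (THE g. continuous_on UNIV g \<and> g 0 = 0 \<and> (\<forall>u. exp (g u) = f u))"

definition cf_power :: "(real \<Rightarrow> complex) \<Rightarrow> real \<Rightarrow> real \<Rightarrow> complex" where
  "cf_power f s u = exp (of_real s * continuous_log f u)"

definition semi_stable :: "real \<Rightarrow> real \<Rightarrow> (real \<Rightarrow> complex) \<Rightarrow> bool" where
  "semi_stable a b f \<longleftrightarrow>
     0 < b \<and> b < 1 \<and> 1 < a \<and> (\<exists>\<alpha>. 0 < \<alpha> \<and> \<alpha> \<le> 2 \<and> a * b powr \<alpha> = 1) \<and>
     characteristic_function f \<and>
     (\<forall>u. f u \<noteq> 0) \<and> (\<forall>u. f u = cf_power f a (b * u))"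

definition semi_selfdecomposable :: "real \<Rightarrow> real measure \<Rightarrow> bool" where
  "semi_selfdecomposable b M \<longleftrightarrow>
     0 < b \<and> b < 1 \<and> real_distribution M \<and>
     (\<exists>f\<^sub>o. infinitely_divisible_cf f\<^sub>o \<and> (\<forall>u. char M u = char M (b * u) * f\<^sub>o u))"

lemma ex1_continuous_log:
  fixes f :: "real \<Rightarrow> complex"
  assumes cont: "continuous_on UNIV f" and nz: "\<And>u. f u \<noteq> 0" and f0: "f 0 = 1"
  shows "\<exists>!g. continuous_on UNIV g \<and> g 0 = 0 \<and> (\<forall>u. exp (g u) = f u)"
proof (rule ex_ex1I)
  obtain g where g: "continuous_on UNIV g" "\<And>u. f u = exp (g u)"
    using continuous_logarithm_on_contractible[OF cont contractible_UNIV] nz by auto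
  have "exp (g 0) = 1"
    using g f0 by metis
  then have "\<forall>u. exp (g u - g 0) = f u"
    using g by (simp add: exp_diff)
  moreover have "continuous_on UNIV (\<lambda>u. g u - g 0)"
    using g by (intro continuous_intros)
  ultimately show "\<exists>g. continuous_on UNIV g \<and> g 0 = 0 \<and> (\<forall>u. exp (g u) = f u)"
    by (intro exI[of _ "\<lambda>u. g u - g 0"]) auto
next
  fix g h :: "real \<Rightarrow> complex"
  assume g: "continuous_on UNIV g \<and> g 0 = 0 \<and> (\<forall>u. exp (g u) = f u)"
    and h: "continuous_on UNIV h \<and> h 0 = 0 \<and> (\<forall>u. exp (h u) = f u)"
  have one: "exp (g u - h u) = 1" for u
    using g h nz by (simp add: exp_diff)
  have sep: "2 * pi \<le> norm ((g y - h y) - (g x - h x))"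
    if "g y - h y \<noteq> g x - h x" for x y
  proof -
    have "\<exists>n::int. g z - h z = of_real (of_int (2 * n) * pi) * \<i>" for z
      using one[of z, unfolded exp_eq_1] by (auto simp: complex_eq_iff)
    then obtain m n :: int where "g y - h y = of_real (of_int (2 * m) * pi) * \<i>"
      "g x - h x = of_real (of_int (2 * n) * pi) * \<i>"
      by metis
    then have eq: "(g y - h y) - (g x - h x) = of_real (2 * pi * of_int (m - n)) * \<i>"
      and "m \<noteq> n"
      using that by (auto simp: algebra_simps)
    then have "1 \<le> \<bar>real_of_int (m - n)\<bar>"
      by linarith
    then show ?thesis
      unfolding eq norm_mult norm_of_real by (simp add: abs_mult)
  qed
  have "(\<lambda>u. g u - h u) constant_on UNIV"
  proof (rule continuous_discrete_range_constant)
    show "continuous_on UNIV (\<lambda>u. g u - h u)"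
      using g h by (intro continuous_intros) auto
    show "\<exists>e>0. \<forall>y. y \<in> UNIV \<and> g y - h y \<noteq> g x - h x \<longrightarrow>
            e \<le> norm ((g y - h y) - (g x - h x))" for x
      using sep by (intro exI[of _ "2 * pi"]) auto
  qed auto
  then obtain c where c: "\<And>u. g u - h u = c"
    by (auto simp: constant_on_def)
  have "c = 0"
    using c[of 0] g h by simp
  then show "g = h"
    using c by (auto simp: fun_eq_iff)
qed

lemma ex1_continuous_log_characteristic_function:
  assumes "characteristic_function f" and "\<And>u. f u \<noteq> 0"
  shows "\<exists>!g. continuous_on UNIV g \<and> g 0 = 0 \<and> (\<forall>u. exp (g u) = f u)"
proof -
  obtain M where M: "real_distribution M" "char M = f"
    using assms(1) by (auto simp: characteristic_function_def)
  have "continuous_on UNIV f"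
    using real_distribution.isCont_char[OF M(1)] M(2)
    by (auto intro: continuous_at_imp_continuous_on)
  moreover have "f 0 = 1"
    using real_distribution.char_zero[OF M(1)] M(2) by simp
  ultimately show ?thesis
    using assms(2) by (intro ex1_continuous_log)
qed

end

theory Submission
  imports Defs
begin

text \<open>Let \<open>\<psi>\<close> be the continuous logarithm of \<open>f\<close>. By uniqueness, semi-stability says
  \<open>\<psi> u = a * \<psi> (b * u)\<close>, so \<open>f u / f (b * u) = exp ((1 - 1 / a) * \<psi> u)\<close>, and it is enough that
  \<open>exp (c * \<psi>)\<close> is a characteristic function for every \<open>c \<ge> 0\<close>. Iterating,
  \<open>\<psi> u = a ^ n * \<psi> (b ^ n * u)\<close>. With \<open>k\<^sub>n = \<lfloor>c * a ^ n\<rfloor>\<close>, the function \<open>f (b ^ n * u) ^ k\<^sub>n\<close> is the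
  characteristic function of a rescaled convolution power, and it equals
  \<open>exp (k\<^sub>n / a ^ n * \<psi> u)\<close>, which tends to \<open>exp (c * \<psi> u)\<close>. Levy's continuity theorem, in the
  form where the limit is only assumed continuous at \<open>0\<close>, finishes the proof.\<close>

section \<open>Closure properties of characteristic functions\<close>

lemma characteristic_function_one: "characteristic_function (\<lambda>_. 1)"
proof -
  interpret prob_space "return borel (0::real)"
    by (rule prob_space_return) simp
  have "real_distribution (return borel (0::real))"
    by unfold_locales auto
  moreover have "char (return borel 0) = (\<lambda>_. 1)"
    by (simp add: fun_eq_iff char_def integral_return)
  ultimately show ?thesis
    unfolding characteristic_function_def by blast
qed

text \<open>The product belongs to the sum of two independent variables, realised as the image of
  the product measure under addition; Fubini then factorises the integral.\<close>

lemma characteristic_function_mult: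
  assumes "characteristic_function f" "characteristic_function g"
  shows "characteristic_function (\<lambda>u. f u * g u)"
proof -
  obtain M N where M: "real_distribution M" "char M = f" and N: "real_distribution N" "char N = g"
    using assms by (auto simp: characteristic_function_def)
  interpret M: real_distribution M by fact
  interpret N: real_distribution N by fact
  interpret P: pair_prob_space M N ..
  have meas: "(\<lambda>(x, y). x + y) \<in> borel_measurable (M \<Otimes>\<^sub>M N)"
    by measurable
  have "char (distr (M \<Otimes>\<^sub>M N) borel (\<lambda>(x, y). x + y)) u = f u * g u" for u
  proof -
    have int: "integrable (M \<Otimes>\<^sub>M N) (\<lambda>(x, y). iexp (u * x) * iexp (u * y))"
      by (rule P.integrable_const_bound[where B = 1]) (auto simp: norm_mult)
    have "char (distr (M \<Otimes>\<^sub>M N) borel (\<lambda>(x, y). x + y)) u =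
        (CLINT z|M \<Otimes>\<^sub>M N. case z of (x, y) \<Rightarrow> iexp (u * x) * iexp (u * y))"
      unfolding char_def using meas
      by (subst integral_distr) (auto simp: algebra_simps exp_add intro!: Bochner_Integration.integral_cong)
    also have "\<dots> = (CLINT x|M. CLINT y|N. iexp (u * x) * iexp (u * y))"
      using P.integral_fst[OF int] by simp
    also have "\<dots> = f u * g u"
      unfolding M(2)[symmetric] N(2)[symmetric] char_def by simp
    finally show ?thesis .
  qed
  moreover have "real_distribution (distr (M \<Otimes>\<^sub>M N) borel (\<lambda>(x, y). x + y))"
    using meas by (rule P.real_distribution_distr)
  ultimately show ?thesis
    unfolding characteristic_function_def by blast
qed

lemma characteristic_function_power:
  assumes "characteristic_function f"
  shows "characteristic_function (\<lambda>u. f u ^ n)"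
  by (induction n) (auto intro: characteristic_function_one characteristic_function_mult assms)

lemma characteristic_function_scale:
  assumes "characteristic_function f"
  shows "characteristic_function (\<lambda>u. f (c * u))"
proof -
  obtain M where M: "real_distribution M" "char M = f"
    using assms by (auto simp: characteristic_function_def)
  interpret M: real_distribution M by fact
  have "char (distr M borel (\<lambda>x. c * x)) u = f (c * u)" for u
    unfolding M(2)[symmetric] char_def
    by (subst integral_distr) (auto simp: mult_ac)
  moreover have "real_distribution (distr M borel (\<lambda>x. c * x))"
    by (rule M.real_distribution_distr) simp
  ultimately show ?thesis
    unfolding characteristic_function_def by blast
qed

section \<open>Tail bounds, tightness and Levy's continuity theorem\<close>

text \<open>Fubini for the bounded kernel \<open>iexp (s * t * x)\<close>, which is symmetric in
  \<open>t\<close> and \<open>x\<close>.\<close>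

lemma integral_char_swap:
  assumes "real_distribution M" "real_distribution N"
  shows "(CLINT t|N. char M (s * t)) = (CLINT x|M. char N (s * x))"
proof -
  interpret M: real_distribution M by fact
  interpret N: real_distribution N by fact
  interpret P: pair_prob_space M N ..
  have "integrable (M \<Otimes>\<^sub>M N) (\<lambda>(x, t). iexp (s * t * x))"
    by (rule P.integrable_const_bound[where B = 1]) auto
  from P.Fubini_integral[OF this] show ?thesis
    unfolding char_def by (simp add: mult_ac)
qed

text \<open>Averaging \<open>char M\<close> over a centred Gaussian turns it into a Gaussian integral against \<open>M\<close>,
  so \<open>char M\<close> near \<open>0\<close> controls the tails of \<open>M\<close>.\<close>

lemma tail_bound_char:
  assumes "real_distribution M" and "0 < s"
  shows "measure M {x. 2 / s \<le> \<bar>x\<bar>} \<le> 2 * cmod (1 - (CLINT t|std_normal_distribution. char M (s * t)))"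
proof -
  interpret M: real_distribution M by fact
  let ?A = "{x. 2 / s \<le> \<bar>x\<bar>}"
  let ?h = "\<lambda>x. exp (- ((s * x)\<^sup>2) / 2) :: real"
  have h_int: "integrable M ?h"
    by (rule M.integrable_const_bound[where B = 1]) auto
  have "(CLINT t|std_normal_distribution. char M (s * t)) = (CLINT x|M. complex_of_real (?h x))"
    using integral_char_swap[OF assms(1) real_dist_normal_dist, of s]
    by (simp add: char_std_normal_distribution)
  also have "\<dots> = complex_of_real (LINT x|M. ?h x)"
    by simp
  finally have eq: "1 - (CLINT t|std_normal_distribution. char M (s * t)) =
      complex_of_real (1 - (LINT x|M. ?h x))"
    by simp
  \<comment> \<open>The threshold \<open>2 / s\<close> is chosen so that on the tail the exponent
    \<open>(s * x)\<^sup>2 / 2\<close> is at least 2, which forces \<open>?h x\<close> \<le> 1/2;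
    off the tail only \<open>?h x\<close> \<le> 1 is needed.\<close>
  have bound: "indicator ?A x \<le> 2 * (1 - ?h x)" for x :: real
  proof (cases "x \<in> ?A")
    case True
    then have "2 \<le> \<bar>s * x\<bar>"
      using \<open>0 < s\<close> by (simp add: field_simps abs_mult)
    then have "2\<^sup>2 \<le> \<bar>s * x\<bar>\<^sup>2"
      by (intro power_mono) auto
    then have "2 \<le> (s * x)\<^sup>2 / 2"
      by simp
    moreover have "1 + (s * x)\<^sup>2 / 2 \<le> exp ((s * x)\<^sup>2 / 2)"
      by (rule exp_ge_add_one_self)
    ultimately have "2 \<le> exp ((s * x)\<^sup>2 / 2)"
      by linarith
    then have "?h x \<le> 1 / 2"
      by (simp add: exp_minus field_simps)
    then show ?thesis
      using True by simp
  qed simp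
  have "measure M ?A = (LINT x|M. indicator ?A x)"
    by simp
  also have "\<dots> \<le> (LINT x|M. 2 * (1 - ?h x))"
    using bound h_int by (intro integral_mono) (auto simp: M.emeasure_eq_measure)
  also have "\<dots> = 2 * (1 - (LINT x|M. ?h x))"
    using h_int M.prob_space by simp
  also have "\<dots> \<le> 2 * \<bar>1 - (LINT x|M. ?h x)\<bar>"
    by (intro mult_left_mono abs_ge_self) simp
  finally show ?thesis
    unfolding eq norm_of_real .
qed

text \<open>Continuity of \<open>g\<close> at 0 gives a scale \<open>s\<close> at which the Gaussian
  average of \<open>g\<close> is close to 1. Dominated convergence carries this over to
  \<open>char (M n)\<close> for all large n, where \<open>tail_bound_char\<close> controls the tails
  uniformly; the finitely many other measures are tight one by one.\<close>

lemma tight_if_char_converges: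
  fixes M :: "nat \<Rightarrow> real measure"
  assumes M: "\<And>n. real_distribution (M n)"
    and conv: "\<And>t. (\<lambda>n. char (M n) t) \<longlonglongrightarrow> g t"
    and cont: "isCont g 0"
  shows "tight M"
  unfolding tight_def
proof (intro conjI allI impI M)
  fix \<epsilon> :: real
  assume "0 < \<epsilon>"
  interpret Mn: real_distribution "M n" for n by (rule M)
  interpret G: real_distribution std_normal_distribution by (rule real_dist_normal_dist)
  let ?I = "\<lambda>f s. CLINT t|std_normal_distribution. f (s * t) :: complex"
  \<comment> \<open>Away from 0 nothing is known about the continuity of \<open>g\<close>, so its
    measurability comes from the pointwise limit.\<close>
  have g_meas [measurable]: "g \<in> borel_measurable borel"
    by (rule borel_measurable_LIMSEQ_metric[OF Mn.char_measurable conv])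
  have g_le: "cmod (g t) \<le> 1" for t
    using Mn.cmod_char_le_1
    by (intro LIMSEQ_le_const2[OF tendsto_norm[OF conv]]) auto
  have g0: "g 0 = 1"
    using conv[of 0] by (simp add: Mn.char_zero LIMSEQ_const_iff)
  have "(\<lambda>k. ?I g (1 / real (Suc k))) \<longlonglongrightarrow> (CLINT t|std_normal_distribution. 1)"
  proof (rule integral_dominated_convergence[where w = "\<lambda>_. 1"])
    show "AE t in std_normal_distribution. (\<lambda>k. g (1 / real (Suc k) * t)) \<longlonglongrightarrow> 1"
    proof (rule AE_I2)
      fix t :: real
      have "(\<lambda>k. 1 / real (Suc k) * t) \<longlonglongrightarrow> 0 * t"
        using LIMSEQ_Suc[OF lim_1_over_n] by (intro tendsto_mult tendsto_const) simp
      then show "(\<lambda>k. g (1 / real (Suc k) * t)) \<longlonglongrightarrow> 1"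
        using isCont_tendsto_compose[OF cont] g0 by fastforce
    qed
  qed (use g_le in auto)
  then have "(\<lambda>k. ?I g (1 / real (Suc k))) \<longlonglongrightarrow> 1"
    using G.prob_space by simp
  then have "\<forall>\<^sub>F k in sequentially. dist (?I g (1 / real (Suc k))) 1 < \<epsilon> / 4"
    using \<open>0 < \<epsilon>\<close> by (intro tendstoD) auto
  then obtain k where "dist (?I g (1 / real (Suc k))) 1 < \<epsilon> / 4"
    by (meson eventually_happens' sequentially_bot)
  \<comment> \<open>The scale is fixed before n varies. Two errors of \<epsilon>/4, doubled by the
    factor 2 in the tail bound, add up to \<epsilon>.\<close>
  then obtain s where s: "0 < s" "dist (?I g s) 1 < \<epsilon> / 4"
    by (meson of_nat_0_less_iff zero_less_Suc zero_less_divide_1_iff)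
  have "(\<lambda>n. ?I (char (M n)) s) \<longlonglongrightarrow> ?I g s"
    by (rule integral_dominated_convergence[where w = "\<lambda>_. 1"])
      (use Mn.cmod_char_le_1 conv in auto)
  then have "\<forall>\<^sub>F n in sequentially. dist (?I (char (M n)) s) (?I g s) < \<epsilon> / 4"
    using \<open>0 < \<epsilon>\<close> by (intro tendstoD) auto
  then obtain N where N: "\<And>n. N \<le> n \<Longrightarrow> dist (?I (char (M n)) s) (?I g s) < \<epsilon> / 4"
    by (auto simp: eventually_sequentially)
  have tail: "measure (M n) {x. 2 / s \<le> \<bar>x\<bar>} < \<epsilon>" if "N \<le> n" for n
  proof -
    have "dist 1 (?I (char (M n)) s) < \<epsilon> / 2"
      using N[OF that] s(2) dist_triangle3[of 1 "?I (char (M n)) s" "?I g s"]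
      unfolding dist_commute[of "?I g s" "?I (char (M n)) s"] by linarith
    then show ?thesis
      using tail_bound_char[OF M s(1), of n] by (simp add: dist_norm)
  qed
  have incr: "(\<lambda>k. measure (M n) {- real k<..real k}) \<longlonglongrightarrow> 1" for n
  proof -
    have "\<exists>k. x \<in> {- real k<..real k}" for x
    proof -
      obtain k :: nat where "\<bar>x\<bar> < real k"
        using reals_Archimedean2 by blast
      then show ?thesis
        by (intro exI[of _ k]) auto
    qed
    then have "(\<Union>k. {- real k<..real k}) = UNIV"
      by blast
    moreover have "(\<lambda>k. measure (M n) {- real k<..real k}) \<longlonglongrightarrow> measure (M n) (\<Union>k. {- real k<..real k})"
      by (rule Mn.finite_Lim_measure_incseq) (auto simp: incseq_def)
    ultimately show ?thesis
      using Mn.prob_space by simp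
  qed
  \<comment> \<open>One interval has to serve every n: k is large enough for each n < N, at least
    \<open>2 / s\<close> for the remaining n, and positive so that the interval is
    nondegenerate.\<close>
  have "\<forall>\<^sub>F k in sequentially. \<forall>n\<in>{..<N}. 1 - \<epsilon> < measure (M n) {- real k<..real k}"
    using \<open>0 < \<epsilon>\<close> by (intro eventually_ball_finite ballI order_tendstoD(1)[OF incr]) auto
  moreover have "\<forall>\<^sub>F k in sequentially. 2 / s \<le> real k"
    using filterlim_real_sequentially by (auto simp: filterlim_at_top)
  moreover have "\<forall>\<^sub>F k in sequentially. 0 < k"
    by (rule eventually_gt_at_top)
  ultimately have "\<forall>\<^sub>F k in sequentially. (\<forall>n\<in>{..<N}. 1 - \<epsilon> < measure (M n) {- real k<..real k})
      \<and> 2 / s \<le> real k \<and> 0 < k"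
    by eventually_elim auto
  then obtain k where k: "\<And>n. n < N \<Longrightarrow> 1 - \<epsilon> < measure (M n) {- real k<..real k}"
      "2 / s \<le> real k" "0 < k"
    using eventually_happens'[OF sequentially_bot] by (metis (no_types, lifting) lessThan_iff)
  have "1 - \<epsilon> < measure (M n) {- real k<..real k}" for n
  proof (cases "n < N")
    case False
    have "1 - \<epsilon> < 1 - measure (M n) {x. 2 / s \<le> \<bar>x\<bar>}"
      using tail[of n] False by simp
    also have "\<dots> = measure (M n) (space (M n) - {x. 2 / s \<le> \<bar>x\<bar>})"
      by (rule Mn.prob_compl[symmetric]) simp
    also have "\<dots> \<le> measure (M n) {- real k<..real k}"
      using k(2) by (intro Mn.finite_measure_mono) auto
    finally show ?thesis .
  qed (use k in auto)
  then show "\<exists>a b. a < b \<and> (\<forall>n. 1 - \<epsilon> < measure (M n) {a<..b})"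
    using k(3) by (intro exI[of _ "- real k"] exI[of _ "real k"]) auto
qed

text \<open>Tightness yields a weakly convergent subsequence, and the characteristic function of its
  limit law can only be \<open>g\<close>.\<close>

lemma characteristic_function_limit:
  fixes f :: "nat \<Rightarrow> real \<Rightarrow> complex"
  assumes f: "\<And>n. characteristic_function (f n)"
    and conv: "\<And>t. (\<lambda>n. f n t) \<longlonglongrightarrow> g t"
    and cont: "isCont g 0"
  shows "characteristic_function g"
proof -
  obtain M where M: "\<And>n. real_distribution (M n)" "\<And>n. char (M n) = f n"
    using f unfolding characteristic_function_def by metis
  have "tight M"
    using M conv cont by (intro tight_if_char_converges[of M g]) auto
  then obtain r \<nu> where r: "strict_mono r" and \<nu>: "real_distribution \<nu>" "weak_conv_m (M \<circ> r) \<nu>"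
    using tight_imp_convergent_subsubsequence[of M id] by (auto simp: strict_mono_def)
  have "char \<nu> t = g t" for t
  proof (rule LIMSEQ_unique)
    show "(\<lambda>n. char ((M \<circ> r) n) t) \<longlonglongrightarrow> char \<nu> t"
      by (rule levy_continuity1) (use M \<nu> in \<open>auto simp: comp_def\<close>)
    show "(\<lambda>n. char ((M \<circ> r) n) t) \<longlonglongrightarrow> g t"
      using LIMSEQ_subseq_LIMSEQ[OF conv r, of t] M(2) by (simp add: comp_def)
  qed
  then show ?thesis
    using \<nu>(1) unfolding characteristic_function_def by blast
qed

section \<open>Real powers and infinite divisibility\<close>

text \<open>The power with exponent \<open>c / n\<close> is an n-th root of the power with exponent
  \<open>c\<close>.\<close>

lemma real_powers_infinitely_divisible:
  assumes "\<And>c. 0 \<le> c \<Longrightarrow> characteristic_function (\<lambda>u. exp (complex_of_real c * \<psi> u))"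
    and "0 \<le> c"
  shows "infinitely_divisible_cf (\<lambda>u. exp (complex_of_real c * \<psi> u))"
  unfolding infinitely_divisible_cf_def
proof (intro conjI allI impI)
  fix n :: nat
  assume "1 \<le> n"
  then have "exp (complex_of_real c * \<psi> u) = exp (complex_of_real (c / real n) * \<psi> u) ^ n" for u
    by (subst exp_of_nat_mult[symmetric]) simp
  then show "\<exists>g. characteristic_function g \<and> (\<forall>u. exp (complex_of_real c * \<psi> u) = g u ^ n)"
    using assms(1)[of "c / real n"] \<open>0 \<le> c\<close>
    by (intro exI[of _ "\<lambda>u. exp (complex_of_real (c / real n) * \<psi> u)"] conjI allI) simp_all
qed (use assms in auto)

lemma characteristic_function_real_power:
  assumes f: "characteristic_function (\<lambda>u. exp (\<psi> u))"
    and cont: "isCont \<psi> 0"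
    and scale: "\<And>u. \<psi> u = complex_of_real a * \<psi> (b * u)" and "1 < a" and "0 \<le> c"
  shows "characteristic_function (\<lambda>u. exp (complex_of_real c * \<psi> u))"
proof (rule characteristic_function_limit)
  let ?k = "\<lambda>n. nat \<lfloor>c * a ^ n\<rfloor>"
  have iter: "\<psi> u = complex_of_real (a ^ n) * \<psi> (b ^ n * u)" for n u
  proof (induction n arbitrary: u)
    case (Suc n)
    show ?case
      using Suc[of u] scale[of "b ^ n * u"] by (simp add: mult_ac)
  qed simp
  show "characteristic_function (\<lambda>u. exp (complex_of_real (?k n / a ^ n) * \<psi> u))" for n
  proof -
    have "complex_of_real (?k n / a ^ n) * \<psi> u = of_nat (?k n) * \<psi> (b ^ n * u)" for u
      using iter[of u n] \<open>1 < a\<close> by simp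
    then have "(\<lambda>u. exp (complex_of_real (?k n / a ^ n) * \<psi> u)) = (\<lambda>u. exp (\<psi> (b ^ n * u)) ^ ?k n)"
      by (simp only: exp_of_nat_mult)
    then show ?thesis
      using characteristic_function_power[OF characteristic_function_scale[OF f]] by simp
  qed
  \<comment> \<open>Rounding down costs less than 1, hence less than \<open>inverse a ^ n\<close>
    after division by \<open>a ^ n\<close>. As \<open>c * a ^ n\<close> is nonnegative,
    \<open>nat\<close> does not alter the floor.\<close>
  have "(\<lambda>n. real (?k n) / a ^ n) \<longlonglongrightarrow> c"
  proof (rule tendsto_sandwich)
    have "(\<lambda>n. inverse a ^ n) \<longlonglongrightarrow> 0"
      using \<open>1 < a\<close> by (intro LIMSEQ_power_zero) (simp add: inverse_less_1_iff)
    then have "(\<lambda>n. c - inverse a ^ n) \<longlonglongrightarrow> c - 0"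
      by (intro tendsto_diff tendsto_const)
    then show "(\<lambda>n. c - inverse a ^ n) \<longlonglongrightarrow> c"
      by simp
    have k: "real (?k n) = of_int \<lfloor>c * a ^ n\<rfloor>" for n
      using \<open>1 < a\<close> \<open>0 \<le> c\<close> by simp
    show "\<forall>\<^sub>F n in sequentially. c - inverse a ^ n \<le> real (?k n) / a ^ n"
    proof (intro always_eventually allI)
      fix n
      have "c * a ^ n - 1 \<le> real (?k n)"
        unfolding k by linarith
      then have "(c * a ^ n - 1) / a ^ n \<le> real (?k n) / a ^ n"
        using \<open>1 < a\<close> by (intro divide_right_mono) auto
      moreover have "(c * a ^ n - 1) / a ^ n = c - inverse a ^ n"
        using \<open>1 < a\<close> by (simp add: field_simps)
      ultimately show "c - inverse a ^ n \<le> real (?k n) / a ^ n"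
        by simp
    qed
    show "\<forall>\<^sub>F n in sequentially. real (?k n) / a ^ n \<le> c"
      using \<open>1 < a\<close> unfolding k by (intro always_eventually allI) (simp add: divide_le_eq)
  qed simp
  then show "(\<lambda>n. exp (complex_of_real (?k n / a ^ n) * \<psi> u)) \<longlonglongrightarrow> exp (complex_of_real c * \<psi> u)" for u
    by (intro tendsto_intros)
  show "isCont (\<lambda>u. exp (complex_of_real c * \<psi> u)) 0"
    using cont by (intro continuous_intros)
qed

section \<open>Semi-stable laws are semi-selfdecomposable\<close>

theorem theorem2p1:
  fixes a b :: real and M :: "real measure"
  assumes "0 < b" and "b < 1" and "1 < a"
    and "real_distribution M"
    and "semi_stable a b (char M)"
  shows "semi_selfdecomposable b M"
proof -
  define \<psi> where "\<psi> = continuous_log (char M)"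
  have cf: "characteristic_function (char M)" and nz: "\<And>u. char M u \<noteq> 0"
    and stable: "\<And>u. char M u = exp (complex_of_real a * \<psi> (b * u))"
    using assms(5) by (auto simp: semi_stable_def cf_power_def \<psi>_def)
  note ex1 = ex1_continuous_log_characteristic_function[OF cf nz]
  have \<psi>: "continuous_on UNIV \<psi>" "\<psi> 0 = 0" "\<And>u. exp (\<psi> u) = char M u"
    using theI'[OF ex1] unfolding \<psi>_def continuous_log_def by auto
  have "continuous_on UNIV (\<lambda>u. complex_of_real a * \<psi> (b * u))"
    by (intro continuous_intros continuous_on_compose2[OF \<psi>(1)]) auto
  \<comment> \<open>Semi-stability only equates the exponentials. Both sides are continuous
    logarithms of \<open>char M\<close> vanishing at 0, so uniqueness equates the logarithms
    themselves.\<close>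
  then have "(\<lambda>u. complex_of_real a * \<psi> (b * u)) = \<psi>"
    using ex1 \<psi> stable by (metis (no_types, lifting) mult_zero_right)
  then have scale: "\<psi> u = complex_of_real a * \<psi> (b * u)" for u
    by metis
  have "isCont \<psi> 0"
    using \<psi>(1) by (simp add: continuous_on_eq_continuous_at)
  moreover have "characteristic_function (\<lambda>u. exp (\<psi> u))"
    using cf by (simp add: \<psi>(3))
  ultimately have "characteristic_function (\<lambda>u. exp (complex_of_real c * \<psi> u))" if "0 \<le> c" for c
    using scale \<open>1 < a\<close> that by (intro characteristic_function_real_power)
  then have "infinitely_divisible_cf (\<lambda>u. exp (complex_of_real (1 - 1 / a) * \<psi> u))"
    using \<open>1 < a\<close> by (intro real_powers_infinitely_divisible) auto
  \<comment> \<open>By \<open>scale\<close>, \<open>\<psi> (b * u)\<close> is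
    \<open>\<psi> u\<close> divided by \<open>a\<close>, which leaves the share
    \<open>1 - 1 / a\<close> for the cofactor; it is positive because \<open>a\<close> > 1.\<close>
  moreover have "char M u = char M (b * u) * exp (complex_of_real (1 - 1 / a) * \<psi> u)" for u
  proof -
    have "\<psi> u = \<psi> (b * u) + complex_of_real (1 - 1 / a) * \<psi> u"
      using scale[of u] \<open>1 < a\<close> by (simp add: algebra_simps)
    then show ?thesis
      by (metis \<psi>(3) exp_add)
  qed
  ultimately show ?thesis
    using assms unfolding semi_selfdecomposable_def by blast
qed

end
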